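(* Let $X$ be an infinite compact ordered space, i.e. an infinite compact topological space equipped with a linear ordering $<$ such that the family of all open intervals $(a,b)=\{x\in X: a<x<b\}$ and all open rays $(-\infty,b)=\{x\in X: x<b\}$, $(a,\infty)=\{x\in X: a<x\}$ (for $a,b\in X$) is a base of its topology. Then $X$ contains a non-trivial convergent sequence: there exist a sequence $(a_n)_{n<\omega}$ of points of $X$ that is not eventually constant and a point $a\in X$ such that $a_n\to a$.
   Context: A sequence $(a_n)$ converges to $a$ if every open neighbourhood of $a$ contains all but finitely many terms of the sequence. A sequence is trivial if it is eventually constant, and non-trivial otherwise. *)

theory Defs
  imports "HOL-Analysis.Analysis"
begin

definition open_intervals_and_rays :: "'a::linorder set set" where
  "open_intervals_and_rays =
     {{a<..<b} | a b. True} \<union> {{..<b} | b. True} \<union> {{a<..} | a. True}"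

definition trivial_sequence :: "(nat \<Rightarrow> 'a) \<Rightarrow> bool" where
  "trivial_sequence s \<longleftrightarrow> (\<exists>c. eventually (\<lambda>n. s n = c) sequentially)"

end

theory Submission
  imports Defs
begin

text \<open>
  An infinite set contains an injective sequence, which has a monotone subsequence. By compactness
  the latter has a cluster point. All terms of an increasing (decreasing) sequence lie below
  (above) a cluster point, and basic open sets are order-convex, so a basic neighbourhood
  containing one term of the sequence contains all later ones.
\<close>

text \<open>Compactness in filter form: a proper filter on a compact space has a cluster point, here
  applied to the image of \<open>sequentially\<close> under \<open>s\<close>.\<close>

lemma compact_seq_cluster_point:
  fixes s :: "nat \<Rightarrow> 'a::topological_space"
  assumes "compact (UNIV :: 'a set)"
  obtains a where "\<And>U N. open U \<Longrightarrow> a \<in> U \<Longrightarrow> \<exists>n\<ge>N. s n \<in> U"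
proof -
  obtain a where a: "inf (nhds a) (filtermap s sequentially) \<noteq> bot"
    using assms unfolding compact_filter by (force simp: filtermap_bot_iff)
  have "\<exists>n\<ge>N. s n \<in> U" if U: "open U" "a \<in> U" for U N
  proof (rule ccontr)
    assume "\<not> ?thesis"
    \<comment> \<open>A tail of \<open>s\<close> avoiding \<open>U\<close> puts the complement of
      \<open>U\<close> in one filter and \<open>U\<close> in the other, so their infimum would be
      \<open>bot\<close>.\<close>
    then have "eventually (\<lambda>x. x \<notin> U) (filtermap s sequentially)"
      by (auto simp: eventually_filtermap eventually_sequentially)
    moreover have "eventually (\<lambda>x. x \<in> U) (nhds a)"
      using U by (rule eventually_nhds_in_open)
    ultimately have "eventually (\<lambda>_. False) (inf (nhds a) (filtermap s sequentially))"
      by (auto simp: eventually_inf)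
    with a show False
      by (simp add: trivial_limit_def)
  qed
  then show thesis
    by (rule that)
qed

lemma open_intervals_and_rays_convex:
  assumes "B \<in> open_intervals_and_rays" "x \<in> B" "z \<in> B" "x \<le> y" "y \<le> z"
  shows "y \<in> B"
  using assms unfolding open_intervals_and_rays_def
  by (auto intro: order.strict_trans1 order.strict_trans2)

lemma monoseq_tendsto_cluster_point:
  fixes s :: "nat \<Rightarrow> 'a::{linorder, topological_space}"
  assumes basis: "topological_basis (open_intervals_and_rays :: 'a set set)"
    and "monoseq s"
    and cluster: "\<And>U N. open U \<Longrightarrow> a \<in> U \<Longrightarrow> \<exists>n\<ge>N. s n \<in> U"
  shows "s \<longlonglongrightarrow> a"
proof (rule topological_tendstoI)
  \<comment> \<open>The order and the topology of the type are linked only by \<open>basis\<close>,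
    so openness of rays has to come from there.\<close>
  have rays: "open {..<b}" "open {b<..}" for b :: 'a
    by (auto intro!: topological_basis_open[OF basis] simp: open_intervals_and_rays_def)
  have between: "s N \<le> s n \<and> s n \<le> a \<or> a \<le> s n \<and> s n \<le> s N" if "N \<le> n" for N n
  proof (cases "incseq s")
    case True
    have "s n \<le> a"
    proof (rule ccontr)
      assume "\<not> s n \<le> a"
      \<comment> \<open>Now \<open>{..<s n}\<close> is a neighbourhood of \<open>a\<close>, so some
        later term falls below \<open>s n\<close>.\<close>
      then obtain m where "m \<ge> n" "s m < s n"
        using cluster[OF rays(1)[of "s n"], of n] by (auto simp: not_le)
      with True show False
        by (meson incseqD leD)
    qed
    with True that show ?thesis
      by (simp add: incseqD)
  next
    case False
    with \<open>monoseq s\<close> have dec: "decseq s"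
      by (simp add: monoseq_iff)
    have "a \<le> s n"
    proof (rule ccontr)
      assume "\<not> a \<le> s n"
      then obtain m where "m \<ge> n" "s n < s m"
        using cluster[OF rays(2)[of "s n"], of n] by (auto simp: not_le)
      with dec show False
        using decseqD[of s n m] by simp
    qed
    with dec that show ?thesis
      by (simp add: decseqD)
  qed
  fix U assume "open U" "a \<in> U"
  then obtain B where B: "B \<in> open_intervals_and_rays" "a \<in> B" "B \<subseteq> U"
    by (rule topological_basisE[OF basis])
  \<comment> \<open>A single term in \<open>B\<close> suffices: by \<open>between\<close>, every
    later one lies between the two points \<open>s N\<close> and \<open>a\<close> of the convex set
    \<open>B\<close>.\<close>
  then obtain N where "s N \<in> B"
    using cluster topological_basis_open[OF basis] by blast
  then have "s n \<in> U" if "N \<le> n" for n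
    using between[OF that] B open_intervals_and_rays_convex by blast
  then show "eventually (\<lambda>n. s n \<in> U) sequentially"
    by (auto simp: eventually_sequentially)
qed

lemma inj_imp_not_trivial_sequence:
  assumes "inj s"
  shows "\<not> trivial_sequence s"
proof
  assume "trivial_sequence s"
  then obtain c N where "\<And>n. n \<ge> N \<Longrightarrow> s n = c"
    by (auto simp: trivial_sequence_def eventually_sequentially)
  then have "s N = s (Suc N)"
    by simp
  with assms show False
    by (simp add: inj_eq)
qed

theorem theorem2p2p4:
  assumes "infinite (UNIV :: 'a::{linorder, topological_space} set)"
    and "compact (UNIV :: 'a set)"
    and "topological_basis (open_intervals_and_rays :: 'a set set)"
  shows "\<exists>(s :: nat \<Rightarrow> 'a) a. \<not> trivial_sequence s \<and> s \<longlonglongrightarrow> a"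
proof -
  obtain f :: "nat \<Rightarrow> 'a" where f: "inj f"
    using infinite_countable_subset[OF assms(1)] by blast
  obtain r :: "nat \<Rightarrow> nat" where r: "strict_mono r" "monoseq (\<lambda>n. f (r n))"
    using seq_monosub by blast
  \<comment> \<open>Injectivity survives passing to a subsequence, whereas mere non-triviality could
    be lost.\<close>
  have "inj (\<lambda>n. f (r n))"
    using inj_compose[OF f strict_mono_imp_inj_on[OF r(1)]] by (simp add: comp_def)
  moreover obtain a where "\<And>U N. open U \<Longrightarrow> a \<in> U \<Longrightarrow> \<exists>n\<ge>N. f (r n) \<in> U"
    using compact_seq_cluster_point[OF assms(2), of "\<lambda>n. f (r n)"] by blast
  then have "(\<lambda>n. f (r n)) \<longlonglongrightarrow> a"
    by (rule monoseq_tendsto_cluster_point[OF assms(3) r(2)])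
  ultimately show ?thesis
    using inj_imp_not_trivial_sequence by blast
qed

end
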